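(* Let $G$ be a finite simple graph of maximum degree $5$. Then $\chi^t_{\mathrm P}(G)\le 2$; that is, there is a map $\ell: V(G)\cup E(G)\to\{1,2\}$ such that for every edge $uv$ of $G$ we have $\pi_\ell(u)\neq\pi_\ell(v)$, where $\pi_\ell(w)=\ell(w)\cdot\prod_{x\in N(w)}\ell(wx)$.
   Context: A total $k$-labelling of a graph $G$ is a map $\ell: V(G)\cup E(G)\to\{1,\dots,k\}$. For a vertex $w$, $\pi_\ell(w)$ denotes the product of the label of $w$ and the labels of all edges incident to $w$. The labelling is product-proper if $\pi_\ell(u)\ne\pi_\ell(v)$ for every edge $uv$. $\chi^t_{\mathrm P}(G)$ is the smallest $k\ge1$ such that $G$ admits a product-proper total $k$-labelling. *)

theory Defs
  imports Main
begin

locale finite_simple_graph =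
  fixes V :: "'a set" and E :: "'a set set"
  assumes finite_verts: "finite V"
    and edges_two_subsets: "\<And>e. e \<in> E \<Longrightarrow> e \<subseteq> V \<and> card e = 2"

definition neighbourhood :: "'a set set \<Rightarrow> 'a \<Rightarrow> 'a set" where
  "neighbourhood E w = {x. {w, x} \<in> E}"

definition incident_edges :: "'a set set \<Rightarrow> 'a \<Rightarrow> 'a set set" where
  "incident_edges E w = {e \<in> E. w \<in> e}"

definition degree :: "'a set set \<Rightarrow> 'a \<Rightarrow> nat" where
  "degree E w = card (incident_edges E w)"

text \<open>Inserting 0 only fixes the value for the graph without vertices.\<close>
definition max_degree :: "'a set \<Rightarrow> 'a set set \<Rightarrow> nat" where
  "max_degree V E = Max (insert 0 (degree E ` V))"

text \<open>A total labelling is one map on the disjoint union of \<open>V\<close> and \<open>E\<close>: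
  \<open>l (Inl w)\<close> is the label of the vertex \<open>w\<close> and \<open>l (Inr e)\<close> that of the edge \<open>e\<close>.
  Values outside \<open>V <+> E\<close> are irrelevant.\<close>
definition total_labelling :: "'a set \<Rightarrow> 'a set set \<Rightarrow> nat \<Rightarrow> ('a + 'a set \<Rightarrow> nat) \<Rightarrow> bool" where
  "total_labelling V E k l \<longleftrightarrow> (\<forall>z \<in> V <+> E. l z \<in> {1..k})"

definition vertex_product :: "'a set set \<Rightarrow> ('a + 'a set \<Rightarrow> nat) \<Rightarrow> 'a \<Rightarrow> nat" where
  "vertex_product E l w = l (Inl w) * (\<Prod>e \<in> incident_edges E w. l (Inr e))"

definition product_proper :: "'a set set \<Rightarrow> ('a + 'a set \<Rightarrow> nat) \<Rightarrow> bool" where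
  "product_proper E l \<longleftrightarrow> (\<forall>u v. {u, v} \<in> E \<longrightarrow> vertex_product E l u \<noteq> vertex_product E l v)"

definition product_total_chromatic :: "'a set \<Rightarrow> 'a set set \<Rightarrow> nat" where
  "product_total_chromatic V E =
     (LEAST k. k \<ge> 1 \<and> (\<exists>l. total_labelling V E k l \<and> product_proper E l))"

context finite_simple_graph
begin

lemma edge_ends:
  assumes "{u, v} \<in> E"
  shows "u \<in> V" "v \<in> V" "u \<noteq> v"
  using edges_two_subsets[OF assms] by (auto simp: card_insert_if split: if_splits)

lemma incident_edges_conv: "incident_edges E w = (\<lambda>x. {w, x}) ` neighbourhood E w"
proof
  show "incident_edges E w \<subseteq> (\<lambda>x. {w, x}) ` neighbourhood E w"
  proof
    fix e assume "e \<in> incident_edges E w"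
    then have e: "e \<in> E" "w \<in> e" by (auto simp: incident_edges_def)
    then obtain a b where "e = {a, b}" using edges_two_subsets card_2_iff by metis
    with e(2) have "e = {w, a} \<or> e = {w, b}" by auto
    with e(1) show "e \<in> (\<lambda>x. {w, x}) ` neighbourhood E w"
      by (auto simp: neighbourhood_def)
  qed
qed (auto simp: incident_edges_def neighbourhood_def)

lemma inj_on_edge_from: "inj_on (\<lambda>x. {w, x}) A"
  by (auto simp: inj_on_def doubleton_eq_iff)

lemma degree_conv: "degree E w = card (neighbourhood E w)"
  by (simp add: degree_def incident_edges_conv card_image inj_on_edge_from)

lemma vertex_product_conv:
  "vertex_product E l w = l (Inl w) * (\<Prod>x \<in> neighbourhood E w. l (Inr {w, x}))"
  by (simp add: vertex_product_def incident_edges_conv prod.reindex inj_on_edge_from)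

text \<open>The minimum in \<open>product_total_chromatic\<close> is over a nonempty set.\<close>
lemma ex_product_proper_labelling:
  "\<exists>k \<ge> 1. \<exists>l. total_labelling V E k l \<and> product_proper E l"
proof -
  obtain f :: "'a \<Rightarrow> nat" where f: "inj_on f V"
    using finite_imp_inj_to_nat_seg[OF finite_verts] by blast
  define l :: "'a + 'a set \<Rightarrow> nat" where "l = case_sum (\<lambda>v. Suc (f v)) (\<lambda>_. 1)"
  define k where "k = Suc (Max (insert 0 (f ` V)))"
  have "total_labelling V E k l"
    using finite_verts by (auto simp: total_labelling_def l_def k_def)
  moreover have "product_proper E l"
    by (auto simp: product_proper_def vertex_product_def l_def dest: edge_ends inj_onD[OF f])
  moreover have "k \<ge> 1" by (simp add: k_def)
  ultimately show ?thesis by blast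
qed

lemma product_total_chromatic_attained:
  "product_total_chromatic V E \<ge> 1 \<and>
   (\<exists>l. total_labelling V E (product_total_chromatic V E) l \<and> product_proper E l)"
  unfolding product_total_chromatic_def
  by (rule LeastI_ex) (use ex_product_proper_labelling in blast)

end

end

theory Submission
  imports Defs
begin

text \<open>Labels 1 and 2 are powers of 2, so it suffices to find \<open>H \<subseteq> E\<close> (the edges with label 2) and a
  proper colouring \<open>c\<close> with \<open>c v \<in> {degree H v, degree H v + 1}\<close>. Choose \<open>T \<subseteq> V\<close> maximising
  \<open>2 |T| - e(T)\<close>, then \<open>|T|\<close>, and put \<open>S = V - T\<close>. As all degrees are at most 5, both \<open>T\<close> and \<open>S\<close>
  induce graphs of maximum degree at most 2. The vertices of \<open>T\<close> receive colours in \<open>{0, 1, 2}\<close> and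
  those of \<open>S\<close> colours in \<open>{3, 4, 5}\<close>, so only edges inside \<open>T\<close> or \<open>S\<close> can be in conflict.

  A graph of maximum degree 2 has an orientation such that the vertices, if each \<open>v\<close> has at most
  \<open>2 - indeg v\<close> outer edges in \<open>H\<close>, can be coloured from \<open>{0, 1, 2}\<close> by choosing the inner
  edges suitably. Replacing \<open>H\<close> by its complement on the inner edges and \<open>c\<close> by \<open>5 - c\<close>, the same
  orientation colours \<open>S\<close> if every \<open>v \<in> S\<close> has exactly \<open>2 - outdeg v\<close> outer edges in \<open>H\<close>. Hall's
  condition for these demands on \<open>S\<close> and capacities on \<open>T\<close> follows from the fact that exchanging
  \<open>Y \<subseteq> T\<close> for \<open>X \<subseteq> S\<close> does not increase \<open>2 |T| - e(T)\<close>.\<close>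

section \<open>Degree-constrained subgraphs of bipartite graphs\<close>

lemma sum_card_fibres:
  assumes "finite M" "finite X"
  shows "(\<Sum>x\<in>X. card {p \<in> M. f p = x}) = card {p \<in> M. f p \<in> X}"
  using assms(2)
proof (induction X rule: finite_induct)
  case (insert x X)
  have "card {p \<in> M. f p \<in> insert x X} = card ({p \<in> M. f p = x} \<union> {p \<in> M. f p \<in> X})"
    by (rule arg_cong[where f = card]) auto
  also have "\<dots> = card {p \<in> M. f p = x} + card {p \<in> M. f p \<in> X}"
    using assms(1) insert(2) by (intro card_Un_disjoint) auto
  finally show ?case using insert by simp
qed simp

lemma card_filter_insert:
  assumes "finite M" "q \<notin> M"
  shows "card {p \<in> insert q M. P p} = card {p \<in> M. P p} + of_bool (P q)"
proof -
  have "{p \<in> insert q M. P p} = (if P q then insert q {p \<in> M. P p} else {p \<in> M. P p})" by auto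
  then show ?thesis using assms by simp
qed

lemma obtain_maximizer:
  fixes f :: "'a \<Rightarrow> 'b::linorder"
  assumes "finite A" "A \<noteq> {}"
  obtains a where "a \<in> A" "\<And>b. b \<in> A \<Longrightarrow> f b \<le> f a"
proof -
  have "Max (f ` A) \<in> f ` A" using assms by (intro Max_in) auto
  then obtain a where a: "a \<in> A" "f a = Max (f ` A)" by auto
  show ?thesis by (rule that[OF a(1)]) (use assms(1) a(2) in simp)
qed

section \<open>Alternating walks, augmentation and the cut condition\<close>

text \<open>A list entry \<open>(y, x')\<close> stands for two edges: out to \<open>y\<close> along
  an edge outside \<open>M\<close>, then back to \<open>x'\<close> along an edge of
  \<open>M\<close>. Repeated vertices are allowed, so walks can be concatenated freely; loops are
  removed only in \<open>augment\<close>.\<close>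

fun alt_walk :: "('a \<times> 'b) set \<Rightarrow> ('a \<times> 'b) set \<Rightarrow> 'a \<Rightarrow> ('b \<times> 'a) list \<Rightarrow> 'a \<Rightarrow> bool" where
  "alt_walk C M x [] z \<longleftrightarrow> x = z"
| "alt_walk C M x ((y, x') # ps) z \<longleftrightarrow> (x, y) \<in> C - M \<and> (x', y) \<in> M \<and> alt_walk C M x' ps z"

lemma alt_walk_append:
  "alt_walk C M x (ps @ qs) z \<longleftrightarrow> (\<exists>w. alt_walk C M x ps w \<and> alt_walk C M w qs z)"
  by (induction C M x ps z rule: alt_walk.induct) auto

text \<open>The walk tests membership in \<open>M\<close> only for edges at its own right vertices.
  In \<open>augment\<close> this keeps the rest of the walk valid after a switch at a right vertex
  that it does not visit.\<close>

lemma alt_walk_cong: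
  assumes "\<And>u v. v \<in> fst ` set ps \<Longrightarrow> (u, v) \<in> M \<longleftrightarrow> (u, v) \<in> M'" "alt_walk C M x ps z"
  shows "alt_walk C M' x ps z"
  using assms
proof (induction C M x ps z rule: alt_walk.induct)
  case (2 C M x v u ps z)
  have "alt_walk C M' u ps z" using 2 by simp
  then show ?case using 2(2)[of v] 2(3) by simp
qed simp

text \<open>These are the simple b-matchings of the bipartite graph \<open>C\<close>, with
  capacities \<open>d\<close> on the left and \<open>b\<close> on the right.\<close>

definition degree_bounded ::
  "('a \<times> 'b) set \<Rightarrow> ('a \<Rightarrow> nat) \<Rightarrow> ('b \<Rightarrow> nat) \<Rightarrow> ('a \<times> 'b) set \<Rightarrow> bool" where
  "degree_bounded C d b M \<longleftrightarrow> M \<subseteq> C \<and> (\<forall>x. card {p \<in> M. fst p = x} \<le> d x) \<and>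
     (\<forall>y. card {p \<in> M. snd p = y} \<le> b y)"

text \<open>The augmenting walk is used up one switch at a time. Replacing \<open>(u, v)\<close> by
  \<open>(x, v)\<close> keeps the size of \<open>M\<close>, moves the spare capacity from
  \<open>x\<close> to \<open>u\<close> and leaves a shorter walk from \<open>u\<close>. Hence
  \<open>M\<close> is arbitrary in the induction on the length.\<close>

lemma augment:
  assumes "finite C" "degree_bounded C d b M" "card {p \<in> M. fst p = x} < d x"
    and "alt_walk C M x ps z" "(z, y) \<in> C - M" "card {p \<in> M. snd p = y} < b y"
  shows "\<exists>M'. degree_bounded C d b M' \<and> card M' = Suc (card M)"
  using assms(2-6)
proof (induction "length ps" arbitrary: M x ps rule: less_induct)
  case less
  have fM: "finite M" using less(2) assms(1) by (auto simp: degree_bounded_def finite_subset)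
  have direct: ?case if w: "(x, w) \<in> C - M" "card {p \<in> M. snd p = w} < b w" for w
  proof -
    have ins: "card {p \<in> insert (x, w) M. P p} = card {p \<in> M. P p} + of_bool (P (x, w))" for P
      using card_filter_insert[OF fM] w(1) by blast
    have "degree_bounded C d b (insert (x, w) M)"
      using less(2,3) w unfolding degree_bounded_def ins by (auto simp: Suc_le_eq)
    then show ?thesis using w fM by (intro exI[of _ "insert (x, w) M"]) auto
  qed
  show ?case
  proof (cases ps)
    case Nil
    then show ?thesis using direct less by auto
  next
    case (Cons q qs)
    obtain v u where q: "q = (v, u)" by fastforce
    have step: "(x, v) \<in> C - M" "(u, v) \<in> M" "alt_walk C M u qs z"
      using less(4) Cons q by auto
    show ?thesis
    proof (cases "v \<in> fst ` set qs")
      case True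
      \<comment> \<open>If \<open>v\<close> recurs, the loop is cut out: from \<open>x\<close> the
        walk enters \<open>v\<close> once and leaves by the later edge
        \<open>(u', v)\<close>.\<close>
      then obtain u' as bs where qs: "qs = as @ (v, u') # bs"
        by (metis imageE prod.collapse split_list)
      then have "alt_walk C M x ((v, u') # bs) z"
        using step by (auto simp: alt_walk_append)
      then show ?thesis
        using less(1)[of "(v, u') # bs" M x] less(2-6) Cons qs by auto
    next
      case False
      show ?thesis
      proof (cases "card {p \<in> M. snd p = v} < b v")
        case True
        then show ?thesis using direct step by blast
      next
        case unsat: False
        \<comment> \<open>Since \<open>v\<close> is saturated and \<open>y\<close> is not, the
          switch at \<open>v\<close> changes neither the last edge \<open>(z, y)\<close> nor the
          load of \<open>y\<close>.\<close>
        then have yv: "y \<noteq> v" using less(6) by auto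
        define N where "N = M - {(u, v)}"
        define M' where "M' = insert (x, v) N"
        have N: "finite N" "(u, v) \<notin> N" "(x, v) \<notin> N" "M = insert (u, v) N"
          using fM step by (auto simp: N_def)
        have ux: "u \<noteq> x" using step by auto
        have cM: "card {p \<in> M. P p} = card {p \<in> N. P p} + of_bool (P (u, v))" for P
          by (subst N(4)) (rule card_filter_insert[OF N(1,2)])
        have cM': "card {p \<in> M'. P p} = card {p \<in> N. P p} + of_bool (P (x, v))" for P
          unfolding M'_def by (rule card_filter_insert[OF N(1,3)])
        have rows: "card {p \<in> N. fst p = w} + of_bool (u = w) \<le> d w"
          and cols: "card {p \<in> N. snd p = t} + of_bool (v = t) \<le> b t" for w t
          using less(2) unfolding degree_bounded_def cM by simp_all
        have row_x: "card {p \<in> N. fst p = x} < d x" using less(3) unfolding cM by simp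
        have bM': "degree_bounded C d b M'"
          unfolding degree_bounded_def
        proof (intro conjI allI)
          show "M' \<subseteq> C" using less(2) step by (auto simp: M'_def N_def degree_bounded_def)
          show "card {p \<in> M'. fst p = w} \<le> d w" for w
            using rows[of w] row_x unfolding cM' by (cases "w = x") auto
          show "card {p \<in> M'. snd p = t} \<le> b t" for t
            using cols[of t] unfolding cM' by simp
        qed
        have "card {p \<in> M'. fst p = u} < d u"
          using rows[of u] ux unfolding cM' by simp
        moreover have "alt_walk C M' u qs z"
          by (rule alt_walk_cong[OF _ step(3)]) (use False in \<open>auto simp: M'_def N_def\<close>)
        moreover have "(z, y) \<in> C - M'" using less(5) yv by (auto simp: M'_def N_def)
        moreover have "card {p \<in> M'. snd p = y} < b y"
          using less(6) yv unfolding cM cM' by simp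
        moreover have "card M' = card M" using N unfolding M'_def by simp
        ultimately show ?thesis using less(1)[of qs M' u] bM' Cons by auto
      qed
    qed
  qed
qed

text \<open>The hypothesis \<open>hall\<close> is the cut condition for a flow with supplies
  \<open>d\<close>, capacities \<open>b\<close> and unit capacity on each edge of \<open>C\<close>.
  In a largest b-matching, a left vertex \<open>x0\<close> with unmet demand yields a violated cut:
  \<open>X\<close> is what alternating walks from \<open>x0\<close> reach, and \<open>Y\<close> is
  what edges outside \<open>M\<close> reach from \<open>X\<close>. By \<open>augment\<close>, every
  vertex of \<open>Y\<close> is saturated.\<close>

lemma bipartite_factor:
  fixes d :: "'a \<Rightarrow> nat" and b :: "'b \<Rightarrow> nat"
  assumes fin: "finite S" "finite T" and C: "C \<subseteq> S \<times> T"
    and hall: "\<And>X Y. X \<subseteq> S \<Longrightarrow> Y \<subseteq> T \<Longrightarrow>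
      sum d X \<le> sum b Y + card {p \<in> C. fst p \<in> X \<and> snd p \<notin> Y}"
  obtains M where "M \<subseteq> C" "\<And>x. x \<in> S \<Longrightarrow> card {p \<in> M. fst p = x} = d x"
    "\<And>y. card {p \<in> M. snd p = y} \<le> b y"
proof -
  have fC: "finite C" using C fin finite_subset by blast
  have "finite {M. degree_bounded C d b M}"
    by (rule finite_subset[of _ "Pow C"]) (use fC in \<open>auto simp: degree_bounded_def\<close>)
  moreover have "degree_bounded C d b {}" by (simp add: degree_bounded_def)
  ultimately obtain M where M: "degree_bounded C d b M"
    and max: "\<And>M'. degree_bounded C d b M' \<Longrightarrow> card M' \<le> card M"
    using obtain_maximizer[of "{M. degree_bounded C d b M}" card] by (metis empty_iff mem_Collect_eq)
  have MC: "M \<subseteq> C" and fM: "finite M"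
    using M fC by (auto simp: degree_bounded_def finite_subset)
  have "card {p \<in> M. fst p = x0} = d x0" if x0: "x0 \<in> S" for x0
  proof (rule ccontr)
    assume "card {p \<in> M. fst p = x0} \<noteq> d x0"
    then have def: "card {p \<in> M. fst p = x0} < d x0"
      using M by (simp add: degree_bounded_def order.not_eq_order_implies_strict)
    define X where "X = {z. \<exists>ps. alt_walk C M x0 ps z}"
    define Y where "Y = {y. \<exists>x\<in>X. (x, y) \<in> C - M}"
    have "x0 \<in> X" unfolding X_def by (metis alt_walk.simps(1) mem_Collect_eq)
    have ext: "x' \<in> X" if "x \<in> X" "(x, y) \<in> C - M" "(x', y) \<in> M" for x x' y
    proof -
      from that(1) obtain ps where "alt_walk C M x0 ps x" by (auto simp: X_def)
      then have "alt_walk C M x0 (ps @ [(y, x')]) x'"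
        using that by (auto simp: alt_walk_append)
      then show ?thesis by (auto simp: X_def)
    qed
    have XS: "X \<subseteq> S"
    proof
      fix z assume "z \<in> X"
      then obtain ps where "alt_walk C M x0 ps z" by (auto simp: X_def)
      then show "z \<in> S" using x0
      proof (induction ps arbitrary: x0)
        case (Cons q ps)
        then show ?case using MC C by (cases q) auto
      qed simp
    qed
    have YT: "Y \<subseteq> T" using C by (auto simp: Y_def)
    have fXY: "finite X" "finite Y" using XS YT fin finite_subset by blast+
    have sat: "card {p \<in> M. snd p = y} = b y" if "y \<in> Y" for y
    proof (rule ccontr)
      assume "card {p \<in> M. snd p = y} \<noteq> b y"
      then have "card {p \<in> M. snd p = y} < b y"
        using M by (simp add: degree_bounded_def order.not_eq_order_implies_strict)
      moreover obtain x ps where "alt_walk C M x0 ps x" "(x, y) \<in> C - M"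
        using \<open>y \<in> Y\<close> by (auto simp: Y_def X_def)
      ultimately obtain M' where "degree_bounded C d b M'" "card M' = Suc (card M)"
        using augment[OF fC M def] by blast
      then show False using max by fastforce
    qed
    have "sum b Y = card {p \<in> M. snd p \<in> Y}"
      using sum_card_fibres[OF fM fXY(2), of snd] sat by simp
    moreover have "(\<Sum>x\<in>X. card {p \<in> M. fst p = x}) = card {p \<in> M. fst p \<in> X}"
      by (rule sum_card_fibres[OF fM fXY(1)])
    \<comment> \<open>By \<open>ext\<close>, all edges of \<open>M\<close> at \<open>Y\<close> start
      in \<open>X\<close>. An edge of \<open>C\<close> from \<open>X\<close> that ends outside
      \<open>Y\<close> must lie in \<open>M\<close>, by the choice of \<open>Y\<close>.\<close>
    moreover have "{p \<in> M. fst p \<in> X} =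
        {p \<in> M. snd p \<in> Y} \<union> {p \<in> C. fst p \<in> X \<and> snd p \<notin> Y}"
      using MC ext by (auto simp: Y_def)
    moreover have "card ({p \<in> M. snd p \<in> Y} \<union> {p \<in> C. fst p \<in> X \<and> snd p \<notin> Y}) =
        card {p \<in> M. snd p \<in> Y} + card {p \<in> C. fst p \<in> X \<and> snd p \<notin> Y}"
      using fM fC by (intro card_Un_disjoint) auto
    moreover have "(\<Sum>x\<in>X. card {p \<in> M. fst p = x}) < sum d X"
      by (rule sum_strict_mono_ex1[OF fXY(1)])
        (use M def \<open>x0 \<in> X\<close> in \<open>auto simp: degree_bounded_def\<close>)
    ultimately show False using hall[OF XS YT] by simp
  qed
  with M show ?thesis by (intro that[of M]) (auto simp: degree_bounded_def)
qed

section \<open>Graphs of maximum degree two\<close>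

text \<open>A cycle of length \<open>n\<close> is encoded as an \<open>n\<close>-periodic sequence
  on all natural numbers, so that the closing edge is again \<open>{f i, f (Suc i)}\<close> and a
  rotation is an index shift.\<close>

definition cyclic :: "(nat \<Rightarrow> 'a) \<Rightarrow> nat \<Rightarrow> bool" where
  "cyclic f n \<longleftrightarrow> 3 \<le> n \<and> (\<forall>i k. f i = f k \<longleftrightarrow> i mod n = k mod n)"

lemma cyclic_shift:
  assumes "cyclic f n"
  shows "cyclic (\<lambda>i. f (i + j)) n"
proof -
  have "(i + j) mod n = (k + j) mod n \<longleftrightarrow> i mod n = k mod n" for i k
    by (auto simp: nat_mod_eq_iff)
  then show ?thesis using assms by (auto simp: cyclic_def)
qed

text \<open>The colour 2 at \<open>f 0\<close> is not available at \<open>f (n - 1)\<close>, so greedy colouring closes up.\<close>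
lemma colour_cycle_greedy:
  fixes z :: "'a \<Rightarrow> nat"
  assumes f: "cyclic f n" and z0: "z (f 0) \<in> {1, 2}" and zlast: "z (f (n - 1)) = 0"
    and z1: "\<And>i. 0 < i \<Longrightarrow> i < n \<Longrightarrow> z (f i) \<le> 1"
  obtains c where "\<And>i. c (f i) \<le> 2" "\<And>i. c (f i) = z (f i) \<or> c (f i) = Suc (z (f i))"
    "\<And>i. c (f i) \<noteq> c (f (Suc i))"
proof -
  \<comment> \<open>The greedy rule takes \<open>z\<close> unless the predecessor has that colour,
    and \<open>Suc z\<close> otherwise. The start value 2 is permitted because
    \<open>z (f 0)\<close> is 1 or 2.\<close>
  define g :: "nat \<Rightarrow> nat" where
    "g = rec_nat 2 (\<lambda>i a. if z (f (Suc i)) \<noteq> a then z (f (Suc i)) else Suc (z (f (Suc i))))"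
  have g0: "g 0 = 2" and gS: "\<And>i. g (Suc i) =
      (if z (f (Suc i)) \<noteq> g i then z (f (Suc i)) else Suc (z (f (Suc i))))"
    by (simp_all add: g_def)
  have n: "3 \<le> n" and f_eq: "\<And>i k. f i = f k \<longleftrightarrow> i mod n = k mod n"
    using f by (auto simp: cyclic_def)
  have g: "g i \<le> 2 \<and> (g i = z (f i) \<or> g i = Suc (z (f i)))" if "i < n" for i
    using that z0 z1[of i] by (cases i) (auto simp: g0 gS)
  \<comment> \<open>The index of a vertex is determined only modulo \<open>n\<close>, hence the
    reduction after the choice.\<close>
  define c where "c v = g ((SOME i. f i = v) mod n)" for v
  have c: "c (f i) = g (i mod n)" for i
  proof -
    have "f (SOME k. f k = f i) = f i" by (rule someI[of _ i]) simp
    then show ?thesis by (simp add: c_def f_eq)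
  qed
  have f_mod: "f (i mod n) = f i" for i by (simp add: f_eq)
  have neq: "c (f i) \<noteq> c (f (Suc i))" for i
  proof (cases "Suc (i mod n) = n")
    case True
    then have "i mod n = n - 1" by simp
    moreover have "g (n - 1) \<noteq> 2" using g[of "n - 1"] n zlast by auto
    ultimately show ?thesis using True by (simp add: c mod_Suc g0)
  next
    case False
    then show ?thesis by (simp add: c mod_Suc gS)
  qed
  show ?thesis
    by (rule that[of c]) (use g[of "_ mod n"] n neq in \<open>auto simp: c f_mod\<close>)
qed

text \<open>The greedy colouring needs a start with positive \<open>y\<close> after a vertex with
  \<open>y = 0\<close>. If some \<open>y\<close> is positive, the first such index serves with
  \<open>K\<close> empty. If all are zero, choosing the one edge \<open>{f 0, f 1}\<close> creates
  such a start at \<open>f 0\<close>.\<close>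

lemma colour_cycle:
  fixes y :: "'a \<Rightarrow> nat"
  assumes f: "cyclic f n" and y0: "y (f 0) = 0" and y1: "y (f 1) \<le> 2"
    and y2: "\<And>j. 2 \<le> j \<Longrightarrow> j < n \<Longrightarrow> y (f j) \<le> 1"
  obtains K c where "K \<subseteq> range (\<lambda>i. {f i, f (Suc i)})" "\<And>i. c (f i) \<le> (2::nat)"
    "\<And>i. c (f i) = y (f i) + degree K (f i) \<or> c (f i) = Suc (y (f i) + degree K (f i))"
    "\<And>i. c (f i) \<noteq> c (f (Suc i))"
proof -
  have n: "3 \<le> n" and f_eq: "\<And>i k. f i = f k \<longleftrightarrow> i mod n = k mod n"
    using f by (auto simp: cyclic_def)
  have f_mod: "f (i mod n) = f i" for i by (simp add: f_eq)
  show ?thesis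
  proof (cases "\<exists>j. 1 \<le> y (f j)")
    case True
    define j where "j = (LEAST j. 1 \<le> y (f j))"
    have j: "1 \<le> y (f j)" unfolding j_def using True by (rule LeastI_ex)
    have less: "y (f i) = 0" if "i < j" for i
      using not_less_Least[of i "\<lambda>j. 1 \<le> y (f j)"] that unfolding j_def by simp
    have "j \<noteq> 0" using j y0 by (cases j) auto
    have "j < n"
    proof (rule ccontr)
      assume "\<not> j < n"
      moreover have "j mod n < n" using n by simp
      ultimately have "y (f (j mod n)) = 0" by (intro less) simp
      then show False using j f_mod[of j] by simp
    qed
    \<comment> \<open>The value 2 is possible only at \<open>f 1\<close>. If \<open>f 1\<close> is
      not the start, then \<open>j > 1\<close>, and minimality of \<open>j\<close> gives
      \<open>y (f 1) = 0\<close>.\<close>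
    have le1: "y (f k) \<le> 1" if "f k \<noteq> f j" for k
    proof -
      have "k mod n < n" using n by simp
      consider "k mod n = 0" | "k mod n = 1" | "2 \<le> k mod n" by linarith
      then show ?thesis
      proof cases
        case 1
        then show ?thesis using y0 f_mod[of k] by simp
      next
        case 2
        then have "j \<noteq> 1" using that f_mod[of k] by auto
        then have "y (f 1) = 0" using less \<open>j \<noteq> 0\<close> by simp
        then show ?thesis using 2 f_mod[of k] by simp
      next
        case 3
        then show ?thesis using y2[OF 3 \<open>k mod n < n\<close>] f_mod[of k] by simp
      qed
    qed
    have "y (f j) \<le> 2"
      using y1 y2[of j] \<open>j \<noteq> 0\<close> \<open>j < n\<close> by (cases "j = 1") auto
    have last: "f (n - 1 + j) = f (j - 1)"
    proof -
      have "n - 1 + j = n + (j - 1)" using n \<open>j \<noteq> 0\<close> by simp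
      then show ?thesis by (simp add: f_eq)
    qed
    obtain c where c: "\<And>i. c (f (i + j)) \<le> 2"
      "\<And>i. c (f (i + j)) = y (f (i + j)) \<or> c (f (i + j)) = Suc (y (f (i + j)))"
      "\<And>i. c (f (i + j)) \<noteq> c (f (Suc i + j))"
    proof (rule colour_cycle_greedy[OF cyclic_shift[OF f], of y j])
      show "y (f (0 + j)) \<in> {1, 2}" using j \<open>y (f j) \<le> 2\<close> by auto
      show "y (f (n - 1 + j)) = 0" unfolding last using less \<open>j \<noteq> 0\<close> by simp
      show "y (f (i + j)) \<le> 1" if "0 < i" "i < n" for i
      proof (rule le1)
        have "(\<lambda>i. f (i + j)) i \<noteq> (\<lambda>i. f (i + j)) 0"
          using cyclic_shift[OF f, of j] that unfolding cyclic_def by (metis mod_0 mod_less not_less0)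
        then show "f (i + j) \<noteq> f j" by simp
      qed
    qed blast
    \<comment> \<open>The offset \<open>i + (n - 1) * j\<close> reaches \<open>f i\<close> from the
      start \<open>f j\<close> without subtraction, as adding \<open>j\<close> gives
      \<open>i + n * j\<close>.\<close>
    have wrap: "f i = f (i + (n - 1) * j + j)" "f (Suc i) = f (Suc (i + (n - 1) * j) + j)" for i
    proof -
      have "i + (n - 1) * j + j = i + n * j" using n by (cases n) auto
      then have "i + (n - 1) * j + j = i + n * j" "Suc (i + (n - 1) * j) + j = Suc i + n * j"
        by simp_all
      then show "f i = f (i + (n - 1) * j + j)" "f (Suc i) = f (Suc (i + (n - 1) * j) + j)"
        unfolding f_eq by (simp_all only: mod_mult_self2)
    qed
    show ?thesis
    proof (rule that[of "{}" c])
      fix i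
      show "c (f i) \<le> 2" using c(1) wrap(1) by metis
      show "c (f i) = y (f i) + degree {} (f i) \<or> c (f i) = Suc (y (f i) + degree {} (f i))"
        using c(2)[of "i + (n - 1) * j"] unfolding wrap(1)[symmetric]
        by (simp add: degree_def incident_edges_def)
      show "c (f i) \<noteq> c (f (Suc i))" using c(3) wrap by metis
    qed simp
  next
    case False
    then have yz: "y (f j) = 0" for j by (simp add: not_le)
    \<comment> \<open>This edge raises the demand to 1 at \<open>f 0\<close> and \<open>f 1\<close>.
      As \<open>n \<ge> 3\<close>, the vertex \<open>f (n - 1)\<close> is neither of them and keeps
      0.\<close>
    define K where "K = {{f 0, f 1}}"
    have deg: "degree K v = of_bool (v = f 0 \<or> v = f 1)" for v
    proof -
      have "incident_edges K v = (if v = f 0 \<or> v = f 1 then K else {})"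
        by (auto simp: incident_edges_def K_def)
      then show ?thesis by (simp add: degree_def K_def)
    qed
    define z where "z v = y v + degree K v" for v
    obtain c where "\<And>i. c (f i) \<le> 2" "\<And>i. c (f i) = z (f i) \<or> c (f i) = Suc (z (f i))"
      "\<And>i. c (f i) \<noteq> c (f (Suc i))"
    proof (rule colour_cycle_greedy[OF f, of z])
      show "z (f (n - 1)) = 0" using n by (simp add: z_def yz deg f_eq)
    qed (auto simp: z_def yz deg)
    then show ?thesis by (intro that[of K c]) (auto simp: z_def K_def)
  qed
qed

section \<open>Cycles in 2-regular graphs\<close>

lemma (in finite_simple_graph) finite_edges: "finite E"
  by (rule finite_subset[of _ "Pow V"]) (use edges_two_subsets finite_verts in auto)

text \<open>In a longest path, all neighbours of the first vertex lie on the path. Its second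
  neighbour \<open>xs ! j\<close> cannot be an inner vertex, whose two neighbours are its neighbours
  on the path, so it is the last vertex and the path closes. Every cycle vertex then has both its
  neighbours on the cycle, whence the last claim.\<close>

lemma (in finite_simple_graph) obtain_cycle:
  assumes "V \<noteq> {}" and deg: "\<And>v. v \<in> V \<Longrightarrow> degree E v = 2"
  obtains f n where "cyclic f n" "range f \<subseteq> V" "\<And>i. {f i, f (Suc i)} \<in> E"
    "\<And>e i. e \<in> E \<Longrightarrow> f i \<in> e \<Longrightarrow> \<exists>k. e = {f k, f (Suc k)}"
proof -
  define path where "path xs \<longleftrightarrow> distinct xs \<and> set xs \<subseteq> V \<and> xs \<noteq> [] \<and>
    (\<forall>i. Suc i < length xs \<longrightarrow> {xs ! i, xs ! Suc i} \<in> E)" for xs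
  have nb2: "card (neighbourhood E v) = 2" if "v \<in> V" for v
    using deg[OF that] degree_conv by simp
  have nbV: "neighbourhood E v \<subseteq> V" for v using edge_ends by (auto simp: neighbourhood_def)
  have nb_irrefl: "v \<notin> neighbourhood E v" for v
    using edge_ends(3)[of v v] by (auto simp: neighbourhood_def)
  have nb_sym: "u \<in> neighbourhood E v \<longleftrightarrow> v \<in> neighbourhood E u" for u v
    by (simp add: neighbourhood_def insert_commute)
  have pair: "neighbourhood E v = {a, b}"
    if "v \<in> V" "a \<in> neighbourhood E v" "b \<in> neighbourhood E v" "a \<noteq> b" for v a b
    using that nb2[OF that(1)] by (intro card_subset_eq[symmetric])
      (auto simp: neighbourhood_def intro: finite_subset[OF nbV[unfolded neighbourhood_def] finite_verts])
  have "finite {xs. path xs}"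
    by (rule finite_subset[of _ "{xs. set xs \<subseteq> V \<and> distinct xs}"])
      (auto simp: path_def intro: finite_subset_distinct[OF finite_verts, simplified])
  moreover obtain v0 where "v0 \<in> V" using assms(1) by blast
  then have "path [v0]" by (simp add: path_def)
  ultimately obtain xs where xs: "path xs" and max: "\<And>ys. path ys \<Longrightarrow> length ys \<le> length xs"
    using obtain_maximizer[of "{xs. path xs}" length] by (metis empty_iff mem_Collect_eq)
  define n where "n = length xs"
  have dist: "distinct xs" and xsV: "set xs \<subseteq> V" and ne: "xs \<noteq> []"
    and step: "\<And>i. Suc i < n \<Longrightarrow> {xs ! i, xs ! Suc i} \<in> E"
    using xs by (auto simp: path_def n_def)
  have inV: "xs ! i \<in> V" if "i < n" for i using that xsV by (auto simp: n_def)
  have n0: "0 < n" using ne by (simp add: n_def)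
  have nb0: "neighbourhood E (xs ! 0) \<subseteq> set xs"
  proof
    fix w assume w: "w \<in> neighbourhood E (xs ! 0)"
    show "w \<in> set xs"
    proof (rule ccontr)
      assume "w \<notin> set xs"
      then have "path (w # xs)"
        using w dist xsV subsetD[OF nbV w] step unfolding path_def n_def
        by (auto simp: nth_Cons neighbourhood_def insert_commute split: nat.splits)
      then show False using max[of "w # xs"] by simp
    qed
  qed
  \<comment> \<open>The first vertex is not its own neighbour, so the path has more than two
    vertices.\<close>
  have "neighbourhood E (xs ! 0) \<subset> set xs"
    using nb0 nb_irrefl[of "xs ! 0"] n0 by (metis n_def nth_mem psubsetI)
  then have "card (neighbourhood E (xs ! 0)) < card (set xs)" by (intro psubset_card_mono) auto
  then have n3: "3 \<le> n" using nb2[OF inV[OF n0]] distinct_card[OF dist] by (simp add: n_def)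
  have eq: "xs ! i = xs ! k \<longleftrightarrow> i = k" if "i < n" "k < n" for i k
    using that dist by (simp add: n_def nth_eq_iff_index_eq)
  have inner: "neighbourhood E (xs ! i) = {xs ! (i - 1), xs ! Suc i}" if "0 < i" "Suc i < n" for i
    using that step[of i] step[of "i - 1"] inV[of i] eq[of "i - 1" "Suc i"]
    by (intro pair) (auto simp: neighbourhood_def insert_commute)
  have fst_nb: "xs ! 1 \<in> neighbourhood E (xs ! 0)"
    using step[of 0] n3 by (simp add: neighbourhood_def)
  obtain w where w: "w \<in> neighbourhood E (xs ! 0)" "w \<noteq> xs ! 1"
    using nb2[OF inV[OF n0]] by (metis card_2_iff insertI1 insertI2)
  then obtain j where j: "w = xs ! j" "j < n" using nb0 by (metis in_set_conv_nth n_def subsetD)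
  have j01: "j \<noteq> 0" "j \<noteq> 1" using w j nb_irrefl by (metis, auto)
  have jlast: "j = n - 1"
  proof (rule ccontr)
    assume "j \<noteq> n - 1"
    then have jn: "Suc j < n" using j by simp
    have "xs ! 0 \<in> neighbourhood E (xs ! j)" using w j nb_sym by blast
    moreover have "neighbourhood E (xs ! j) = {xs ! (j - 1), xs ! Suc j}"
      using inner jn j01 by simp
    ultimately consider "xs ! 0 = xs ! (j - 1)" | "xs ! 0 = xs ! Suc j" by blast
    then show False
    proof cases
      case 1
      then have "0 = j - 1" by (subst (asm) eq) (use n0 jn in simp_all)
      then show False using j01 by simp
    next
      case 2
      then show False by (subst (asm) eq) (use n0 jn in simp_all)
    qed
  qed
  have zero: "neighbourhood E (xs ! 0) = {xs ! (n - 1), xs ! 1}"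
    using w j jlast fst_nb inV[OF n0] by (intro pair) auto
  have last: "neighbourhood E (xs ! (n - 1)) = {xs ! (n - 2), xs ! 0}"
  proof (rule pair)
    show "xs ! (n - 1) \<in> V" using inV n3 by simp
    have "Suc (n - 2) = n - 1" using n3 by simp
    then show "xs ! (n - 2) \<in> neighbourhood E (xs ! (n - 1))"
      using step[of "n - 2"] n3 by (simp add: neighbourhood_def insert_commute)
    show "xs ! 0 \<in> neighbourhood E (xs ! (n - 1))" using zero nb_sym by blast
    show "xs ! (n - 2) \<noteq> xs ! 0" using eq n3 by simp
  qed
  define f where "f i = xs ! (i mod n)" for i
  have cyc: "cyclic f n"
    using n3 eq by (simp add: cyclic_def f_def)
  \<comment> \<open>The predecessor of \<open>f i\<close> is written \<open>f (i + (n - 1))\<close>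
    to avoid truncated subtraction at \<open>i = 0\<close>.\<close>
  have nb: "neighbourhood E (f i) = {f (i + (n - 1)), f (Suc i)}" for i
  proof -
    have *: "(i + (n - 1)) mod n = (if i mod n = 0 then n - 1 else i mod n - 1)"
    proof (cases "i mod n")
      case 0
      then show ?thesis using n3 by (metis mod_add_left_eq add_0 diff_less mod_less n0 zero_less_one)
    next
      case (Suc k)
      have "(i + (n - 1)) mod n = (i mod n + (n - 1)) mod n" by (simp add: mod_add_left_eq)
      also have "i mod n + (n - 1) = k + n" using Suc n3 by simp
      also have "(k + n) mod n = k" using Suc by (metis Suc_lessD mod_add_self2 mod_less mod_less_divisor n0)
      finally show ?thesis using Suc by simp
    qed
    have **: "Suc i mod n = (if Suc (i mod n) = n then 0 else Suc (i mod n))" by (rule mod_Suc)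
    consider "i mod n = 0" | "i mod n = n - 1" | "0 < i mod n" "Suc (i mod n) < n"
      using mod_less_divisor[OF n0, of i] by linarith
    then show ?thesis
    proof cases
      case 1
      then show ?thesis using zero n3 unfolding f_def * ** 1 by simp
    next
      case 2
      have "n - 1 - 1 = n - 2" "n - 1 \<noteq> 0" "Suc (n - 1) = n" using n3 by simp_all
      then show ?thesis using last unfolding f_def * ** 2 by simp
    next
      case 3
      then show ?thesis using inner[OF 3] unfolding f_def * ** by simp
    qed
  qed
  show ?thesis
  proof (rule that[of f n])
    show "range f \<subseteq> V" using inV n0 by (auto simp: f_def)
    show "{f i, f (Suc i)} \<in> E" for i using nb[of i] by (auto simp: neighbourhood_def)
    fix e i assume e: "e \<in> E" "f i \<in> e"
    then obtain w where w: "e = {f i, w}" "w \<in> neighbourhood E (f i)"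
      using incident_edges_conv[of "f i"] by (auto simp: incident_edges_def)
    have "f (Suc (i + (n - 1))) = f i" using n3 by (simp add: f_def)
    then show "\<exists>k. e = {f k, f (Suc k)}" using w nb[of i] by (metis doubleton_eq_iff insertE singletonD)
  qed (rule cyc)
qed

section \<open>Orientations that guarantee a colouring\<close>

text \<open>\<open>h e\<close> is the head of \<open>e\<close>, and \<open>y v\<close> stands for the number of chosen edges at \<open>v\<close>
  that lie outside \<open>F\<close>.\<close>
definition colouring_orientation :: "'a set \<Rightarrow> 'a set set \<Rightarrow> ('a set \<Rightarrow> 'a) \<Rightarrow> bool" where
  "colouring_orientation W F h \<longleftrightarrow> (\<forall>e\<in>F. h e \<in> e) \<and>
     (\<forall>y. (\<forall>v\<in>W. y v + card {e \<in> F. h e = v} \<le> 2) \<longrightarrow>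
       (\<exists>K c. K \<subseteq> F \<and> (\<forall>u v. {u, v} \<in> F \<longrightarrow> c u \<noteq> c v) \<and>
         (\<forall>v\<in>W. c v \<le> (2::nat) \<and> (c v = y v + degree K v \<or> c v = Suc (y v + degree K v)))))"

lemma colouring_orientationE:
  assumes "colouring_orientation W F h" "\<forall>v\<in>W. y v + card {e \<in> F. h e = v} \<le> 2"
  obtains K c where "K \<subseteq> F" "\<And>u v. {u, v} \<in> F \<Longrightarrow> c u \<noteq> c v"
    "\<And>v. v \<in> W \<Longrightarrow> c v \<le> (2::nat)"
    "\<And>v. v \<in> W \<Longrightarrow> c v = y v + degree K v \<or> c v = Suc (y v + degree K v)"
proof -
  from assms(1)[unfolded colouring_orientation_def, THEN conjunct2, THEN spec[of _ y], THEN mp, OF assms(2)]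
  obtain K c where "K \<subseteq> F \<and> (\<forall>u v. {u, v} \<in> F \<longrightarrow> c u \<noteq> c v) \<and>
      (\<forall>v\<in>W. c v \<le> (2::nat) \<and> (c v = y v + degree K v \<or> c v = Suc (y v + degree K v)))"
    by (elim exE)
  then show ?thesis by (intro that[of K c]) simp_all
qed

text \<open>The rest \<open>W - A\<close> is coloured first and \<open>A\<close> afterwards. Edges
  meeting \<open>A\<close> have their head in \<open>A\<close>, so indegrees outside
  \<open>A\<close> are those of the rest. Only edges inside \<open>A\<close> are added to
  \<open>K\<close>, so degrees outside \<open>A\<close> stay fixed. Since \<open>colour\<close>
  admits every \<open>c'\<close>, the colouring of \<open>A\<close> can react to the rest.\<close>

lemma colouring_orientation_extend:
  assumes F: "\<And>e. e \<in> F \<Longrightarrow> e \<subseteq> W" and "A \<subseteq> W"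
    and h: "colouring_orientation (W - A) {e \<in> F. e \<inter> A = {}} h"
    and hA: "\<And>e. e \<in> F \<Longrightarrow> e \<inter> A \<noteq> {} \<Longrightarrow> hA e \<in> e \<inter> A"
    and colour: "\<And>y c'. (\<And>v. v \<in> A \<Longrightarrow> y v + card {e \<in> F. e \<inter> A \<noteq> {} \<and> hA e = v} \<le> 2) \<Longrightarrow>
      \<exists>K c. K \<subseteq> {e \<in> F. e \<subseteq> A} \<and>
        (\<forall>v\<in>A. c v \<le> (2::nat) \<and> (c v = y v + degree K v \<or> c v = Suc (y v + degree K v))) \<and>
        (\<forall>u v. u \<in> A \<longrightarrow> {u, v} \<in> F \<longrightarrow> c u \<noteq> (if v \<in> A then c v else c' v))"
  shows "colouring_orientation W F (\<lambda>e. if e \<inter> A = {} then h e else hA e)"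
  unfolding colouring_orientation_def
proof (intro conjI allI impI ballI)
  let ?F = "{e \<in> F. e \<inter> A = {}}" and ?h = "\<lambda>e. if e \<inter> A = {} then h e else hA e"
  have h_in: "\<And>e. e \<in> ?F \<Longrightarrow> h e \<in> e" using h unfolding colouring_orientation_def by blast
  show "?h e \<in> e" if "e \<in> F" for e using h_in hA that by (cases "e \<inter> A = {}") auto
  fix y :: "'a \<Rightarrow> nat"
  assume y: "\<forall>v\<in>W. y v + card {e \<in> F. ?h e = v} \<le> 2"
  have heads: "{e \<in> F. ?h e = v} = {e \<in> ?F. h e = v}" if "v \<in> W - A" for v
  proof -
    have "?h e = v \<longleftrightarrow> e \<inter> A = {} \<and> h e = v" if "e \<in> F" for e
      using hA[OF that] \<open>v \<in> W - A\<close> by (cases "e \<inter> A = {}") auto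
    then show ?thesis by blast
  qed
  have "\<forall>v\<in>W - A. y v + card {e \<in> ?F. h e = v} \<le> 2"
  proof
    fix v assume "v \<in> W - A"
    then show "y v + card {e \<in> ?F. h e = v} \<le> 2"
      unfolding heads[OF \<open>v \<in> W - A\<close>, symmetric] using y by blast
  qed
  then obtain K' c' where K': "K' \<subseteq> ?F" and c': "\<And>u v. {u, v} \<in> ?F \<Longrightarrow> c' u \<noteq> c' v"
    "\<And>v. v \<in> W - A \<Longrightarrow> c' v \<le> 2"
    "\<And>v. v \<in> W - A \<Longrightarrow> c' v = y v + degree K' v \<or> c' v = Suc (y v + degree K' v)"
    by (rule colouring_orientationE[OF h]) (rule that)
  have "y v + card {e \<in> F. e \<inter> A \<noteq> {} \<and> hA e = v} \<le> 2" if "v \<in> A" for v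
  proof -
    have "?h e = v \<longleftrightarrow> e \<inter> A \<noteq> {} \<and> hA e = v" if "e \<in> F" for e
      using h_in[of e] that \<open>v \<in> A\<close> by (cases "e \<inter> A = {}") auto
    then have *: "{e \<in> F. ?h e = v} = {e \<in> F. e \<inter> A \<noteq> {} \<and> hA e = v}" by blast
    have "v \<in> W" using that \<open>A \<subseteq> W\<close> by blast
    then show ?thesis using bspec[OF y] unfolding *[symmetric] by blast
  qed
  from colour[OF this, of c'] obtain K c where K: "K \<subseteq> {e \<in> F. e \<subseteq> A}"
    and c: "\<And>v. v \<in> A \<Longrightarrow> c v \<le> 2 \<and> (c v = y v + degree K v \<or> c v = Suc (y v + degree K v))"
      "\<And>u v. u \<in> A \<Longrightarrow> {u, v} \<in> F \<Longrightarrow> c u \<noteq> (if v \<in> A then c v else c' v)"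
    by blast
  have "incident_edges (K \<union> K') v = incident_edges K v" if "v \<in> A" for v
    using K K' that by (auto simp: incident_edges_def)
  then have deg_in: "degree (K \<union> K') v = degree K v" if "v \<in> A" for v
    using that by (simp add: degree_def)
  have "incident_edges (K \<union> K') v = incident_edges K' v" if "v \<notin> A" for v
    using K K' that by (auto simp: incident_edges_def)
  then have deg_out: "degree (K \<union> K') v = degree K' v" if "v \<notin> A" for v
    using that by (simp add: degree_def)
  let ?c = "\<lambda>v. if v \<in> A then c v else c' v"
  have "?c u \<noteq> ?c v" if "{u, v} \<in> F" for u v
  proof -
    consider "u \<in> A" | "v \<in> A" | "u \<notin> A" "v \<notin> A" by blast
    then show ?thesis
    proof cases
      case 1
      then show ?thesis using c(2)[OF _ that] by simp
    next
      case 2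
      have "{v, u} \<in> F" using that by (simp add: insert_commute)
      then show ?thesis using c(2)[OF 2] 2 by metis
    next
      case 3
      then show ?thesis using c'(1)[of u v] that by simp
    qed
  qed
  moreover have "K \<union> K' \<subseteq> F" using K K' by auto
  ultimately show "\<exists>K c. K \<subseteq> F \<and> (\<forall>u v. {u, v} \<in> F \<longrightarrow> c u \<noteq> c v) \<and>
      (\<forall>v\<in>W. c v \<le> 2 \<and> (c v = y v + degree K v \<or> c v = Suc (y v + degree K v)))"
    using c(1) c'(2,3) by (intro exI[of _ "K \<union> K'"] exI[of _ ?c]) (auto simp: deg_in deg_out)
qed

text \<open>Induction on the number of vertices, splitting off a vertex of degree at most 1 or, if
  all degrees are 2, a whole cycle.\<close>

lemma ex_colouring_orientation:
  assumes "finite_simple_graph W F" "\<And>v. v \<in> W \<Longrightarrow> degree F v \<le> 2"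
  shows "\<exists>h. colouring_orientation W F h"
  using assms
proof (induction "card W" arbitrary: W F rule: less_induct)
  case less
  interpret finite_simple_graph W F by (rule less(2))
  have sub: "\<exists>h. colouring_orientation (W - A) {e \<in> F. e \<inter> A = {}} h" if A: "A \<subseteq> W" "A \<noteq> {}" for A
  proof (rule less(1))
    show "card (W - A) < card W" using A finite_verts by (intro psubset_card_mono) auto
    show "finite_simple_graph (W - A) {e \<in> F. e \<inter> A = {}}"
      using finite_verts edges_two_subsets by unfold_locales auto
    fix v assume "v \<in> W - A"
    moreover have "degree {e \<in> F. e \<inter> A = {}} v \<le> degree F v"
      unfolding degree_def incident_edges_def using finite_edges by (intro card_mono) auto
    ultimately show "degree {e \<in> F. e \<inter> A = {}} v \<le> 2" using less(3)[of v] by simp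
  qed
  consider "W = {}" | v where "v \<in> W" "degree F v \<le> 1"
    | "W \<noteq> {}" "\<And>v. v \<in> W \<Longrightarrow> degree F v = 2"
    using less(3) by force
  then show ?case
  proof cases
    case 1
    then have "F = {}" using edges_two_subsets by fastforce
    then show ?thesis using 1 by (auto simp: colouring_orientation_def)
  next
    case 2
    from sub[of "{v}"] 2 obtain h
      where h: "colouring_orientation (W - {v}) {e \<in> F. e \<inter> {v} = {}} h" by auto
    have "colouring_orientation W F (\<lambda>e. if e \<inter> {v} = {} then h e else v)"
    proof (rule colouring_orientation_extend[OF _ _ h])
      fix y c' :: "'a \<Rightarrow> nat"
      assume "\<And>w. w \<in> {v} \<Longrightarrow> y w + card {e \<in> F. e \<inter> {v} \<noteq> {} \<and> v = w} \<le> 2"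
      from this[of v] have y: "y v + degree F v \<le> 2" by (simp add: degree_def incident_edges_def)
      have fin: "finite (neighbourhood F v)"
        by (rule finite_subset[OF _ finite_verts]) (use edge_ends in \<open>auto simp: neighbourhood_def\<close>)
      have deg: "card (neighbourhood F v) \<le> 1" using 2 by (simp add: degree_conv)
      \<comment> \<open>With at most one neighbour, raising \<open>y v\<close> by one avoids a
        clash. If there is a neighbour, its edge points to \<open>v\<close>, so
        \<open>y v \<le> 1\<close> and the raised colour is at most 2.\<close>
      define a where "a = (if \<exists>u. {v, u} \<in> F \<and> c' u = y v then Suc (y v) else y v)"
      have "a \<le> 2"
      proof (cases "\<exists>u. {v, u} \<in> F \<and> c' u = y v")
        case True
        then have "neighbourhood F v \<noteq> {}" by (auto simp: neighbourhood_def)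
        then have "degree F v \<noteq> 0" using fin by (simp add: degree_conv)
        then show ?thesis using y by (simp add: a_def)
      next
        case False
        then have "a = y v" unfolding a_def by (rule if_not_P)
        then show ?thesis using y by simp
      qed
      moreover have "a \<noteq> c' u" if "{v, u} \<in> F" for u
      proof -
        have eq: "w = u" if "{v, w} \<in> F" for w
          using deg fin \<open>{v, u} \<in> F\<close> that by (auto simp: neighbourhood_def card_le_Suc0_iff_eq)
        show ?thesis
        proof (cases "c' u = y v")
          case True
          then have "a = Suc (y v)" unfolding a_def using that by (intro if_P) blast
          then show ?thesis using True by simp
        next
          case False
          then have "a = y v" unfolding a_def using eq by (intro if_not_P) blast
          then show ?thesis using False by simp
        qed
      qed
      moreover have "a = y v \<or> a = Suc (y v)" by (simp add: a_def)
      ultimately show "\<exists>K c. K \<subseteq> {e \<in> F. e \<subseteq> {v}} \<and>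
          (\<forall>w\<in>{v}. c w \<le> 2 \<and> (c w = y w + degree K w \<or> c w = Suc (y w + degree K w))) \<and>
          (\<forall>u w. u \<in> {v} \<longrightarrow> {u, w} \<in> F \<longrightarrow> c u \<noteq> (if w \<in> {v} then c w else c' w))"
        using edge_ends(3)[of v v]
        by (intro exI[of _ "{}"] exI[of _ "\<lambda>_. a"])
          (auto simp: degree_def incident_edges_def)
    qed (use 2 edges_two_subsets in auto)
    then show ?thesis by blast
  next
    case 3
    obtain f n where f: "cyclic f n" "range f \<subseteq> W" "\<And>i. {f i, f (Suc i)} \<in> F"
      and closed: "\<And>e i. e \<in> F \<Longrightarrow> f i \<in> e \<Longrightarrow> \<exists>k. e = {f k, f (Suc k)}"
    proof (rule obtain_cycle)
      show "W \<noteq> {}" "\<And>v. v \<in> W \<Longrightarrow> degree F v = 2" by (fact 3)+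
    qed (rule that)
    have n: "3 \<le> n" and f_eq: "\<And>i k. f i = f k \<longleftrightarrow> i mod n = k mod n"
      using f(1) by (auto simp: cyclic_def)
    from sub[of "range f"] f(2) obtain h
      where h: "colouring_orientation (W - range f) {e \<in> F. e \<inter> range f = {}} h" by auto
    \<comment> \<open>The cycle is oriented acyclically with source \<open>f 1\<close> and sink
      \<open>f 0\<close>: both edges at \<open>f 0\<close> point to it, and every other edge points
      to its end of larger index below \<open>n\<close>. The indegrees 2 at \<open>f 0\<close>, 0 at
      \<open>f 1\<close> and 1 elsewhere give the bounds on \<open>y\<close> in
      \<open>colour_cycle\<close>.\<close>
    define hA where "hA e = (if f 0 \<in> e then f 0 else f (Max {i \<in> {..<n}. f i \<in> e}))" for e
    have touch: "\<exists>k. e = {f k, f (Suc k)}" if "e \<in> F" "e \<inter> range f \<noteq> {}" for e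
      using that closed by blast
    have "colouring_orientation W F (\<lambda>e. if e \<inter> range f = {} then h e else hA e)"
    proof (rule colouring_orientation_extend[OF _ f(2) h])
      show "e \<subseteq> W" if "e \<in> F" for e using edges_two_subsets that by blast
      show "hA e \<in> e \<inter> range f" if e: "e \<in> F" "e \<inter> range f \<noteq> {}" for e
      proof -
        obtain k where "e = {f k, f (Suc k)}" using touch e by blast
        then have "k mod n \<in> {i \<in> {..<n}. f i \<in> e}" using n by (simp add: f_eq)
        then have "Max {i \<in> {..<n}. f i \<in> e} \<in> {i \<in> {..<n}. f i \<in> e}" by (intro Max_in) auto
        then show ?thesis by (auto simp: hA_def)
      qed
      fix y c' :: "'a \<Rightarrow> nat"
      let ?in = "\<lambda>v. {e \<in> F. e \<inter> range f \<noteq> {} \<and> hA e = v}"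
      assume y: "\<And>v. v \<in> range f \<Longrightarrow> y v + card (?in v) \<le> 2"
      have fin: "finite (?in v)" for v using finite_edges by simp
      have y0: "y (f 0) = 0"
      proof -
        have fn: "f (Suc (n - 1)) = f 0" using n by (simp add: f_eq)
        have "{{f 0, f 1}, {f (n - 1), f 0}} \<subseteq> ?in (f 0)"
          using f(3)[of 0] f(3)[of "n - 1"] unfolding fn by (auto simp: hA_def)
        then have "card {{f 0, f 1}, {f (n - 1), f 0}} \<le> card (?in (f 0))"
          by (rule card_mono[OF fin])
        moreover have "{f 0, f 1} \<noteq> {f (n - 1), f 0}"
          using n by (auto simp: doubleton_eq_iff f_eq)
        ultimately show ?thesis using y[of "f 0"] by simp
      qed
      have y1: "y (f j) \<le> 1" if j: "2 \<le> j" "j < n" for j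
      proof -
        let ?e = "{f (j - 1), f j}"
        have e: "?e \<in> F" using f(3)[of "j - 1"] j by simp
        have "f i \<in> ?e \<longleftrightarrow> i = j - 1 \<or> i = j" if "i < n" for i
          using j that by (simp add: f_eq)
        then have "{i \<in> {..<n}. f i \<in> ?e} = {j - 1, j}" and "f 0 \<notin> ?e"
          using j n by auto
        then have "hA ?e = f j" using j by (simp add: hA_def)
        with e have "?in (f j) \<noteq> {}" by blast
        then have "card (?in (f j)) \<noteq> 0" using fin by simp
        then show ?thesis using y[of "f j"] by simp
      qed
      have "y (f 1) \<le> 2" using y[of "f 1"] by simp
      obtain K c
        where K: "K \<subseteq> range (\<lambda>i. {f i, f (Suc i)})" and c: "\<And>i. c (f i) \<le> (2::nat)"
          "\<And>i. c (f i) = y (f i) + degree K (f i) \<or> c (f i) = Suc (y (f i) + degree K (f i))"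
          "\<And>i. c (f i) \<noteq> c (f (Suc i))"
      proof (rule colour_cycle[of f n y, OF f(1) y0])
        show "y (f 1) \<le> 2" by fact
        show "y (f j) \<le> 1" if "2 \<le> j" "j < n" for j using y1 that .
      qed (rule that)
      have "v \<in> range f \<and> c u \<noteq> c v" if uv: "u \<in> range f" "{u, v} \<in> F" for u v
      proof -
        obtain k where "{u, v} = {f k, f (Suc k)}" using touch[of "{u, v}"] uv by auto
        then show ?thesis using c(3)[of k] by (auto simp: doubleton_eq_iff)
      qed
      then show "\<exists>K c. K \<subseteq> {e \<in> F. e \<subseteq> range f} \<and>
          (\<forall>v\<in>range f. c v \<le> 2 \<and> (c v = y v + degree K v \<or> c v = Suc (y v + degree K v))) \<and>
          (\<forall>u v. u \<in> range f \<longrightarrow> {u, v} \<in> F \<longrightarrow> c u \<noteq> (if v \<in> range f then c v else c' v))"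
        using K c f(3) by (intro exI[of _ K] exI[of _ c]) auto
    qed
    then show ?thesis by blast
  qed
qed

section \<open>Partition and labelling\<close>

text \<open>\<open>T\<close> maximises \<open>2 * card T - card {e \<in> E. e \<subseteq> T}\<close> and has largest size among the maximisers.
  The last claim compares \<open>T\<close> with \<open>(T - Y) \<union> X\<close>.\<close>
lemma (in finite_simple_graph) obtain_exchange_stable_set:
  assumes deg5: "\<And>v. v \<in> V \<Longrightarrow> degree E v \<le> 5"
  obtains T where "T \<subseteq> V" "\<And>v. v \<in> T \<Longrightarrow> degree {e \<in> E. e \<subseteq> T} v \<le> 2"
    "\<And>v. v \<in> V - T \<Longrightarrow> degree {e \<in> E. e \<subseteq> V - T} v \<le> 2"
    "\<And>X Y. X \<subseteq> V - T \<Longrightarrow> Y \<subseteq> T \<Longrightarrow> 2 * card X + card {e \<in> E. e \<subseteq> T \<and> e \<inter> Y \<noteq> {}} \<le>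
      2 * card Y + card {e \<in> E. e \<subseteq> X} + card {e \<in> E. \<exists>x\<in>X. \<exists>t\<in>T - Y. e = {x, t}}"
proof -
  \<comment> \<open>Integers are used because the difference may be negative.\<close>
  define N where "N T = 2 * int (card T) - int (card {e \<in> E. e \<subseteq> T})" for T
  obtain T0 where T0: "T0 \<in> Pow V" "\<And>T. T \<in> Pow V \<Longrightarrow> N T \<le> N T0"
    using obtain_maximizer[of "Pow V" N] finite_verts by blast
  have "finite {T \<in> Pow V. N T = N T0}" using finite_verts by simp
  moreover have "{T \<in> Pow V. N T = N T0} \<noteq> {}" using T0(1) by blast
  ultimately obtain T where T: "T \<in> {T \<in> Pow V. N T = N T0}"
    "\<And>T'. T' \<in> {T \<in> Pow V. N T = N T0} \<Longrightarrow> card T' \<le> card T"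
    by (rule obtain_maximizer[where f = card]) (rule that)
  have TV: "T \<subseteq> V" and maxN: "\<And>T'. T' \<subseteq> V \<Longrightarrow> N T' \<le> N T"
    and tie: "\<And>T'. T' \<subseteq> V \<Longrightarrow> N T' = N T \<Longrightarrow> card T' \<le> card T"
    using T T0 by auto
  have finT: "finite T" using TV finite_verts finite_subset by blast
  show ?thesis
  proof (rule that[OF TV])
    fix v assume v: "v \<in> T"
    have "{e \<in> E. e \<subseteq> T} = {e \<in> E. e \<subseteq> T - {v}} \<union> incident_edges {e \<in> E. e \<subseteq> T} v"
      by (auto simp: incident_edges_def)
    also have "card \<dots> = card {e \<in> E. e \<subseteq> T - {v}} + degree {e \<in> E. e \<subseteq> T} v"
      unfolding degree_def using finite_edges by (intro card_Un_disjoint) (auto simp: incident_edges_def)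
    finally have "card {e \<in> E. e \<subseteq> T} = card {e \<in> E. e \<subseteq> T - {v}} + degree {e \<in> E. e \<subseteq> T} v" .
    moreover have "card T = Suc (card (T - {v}))" using card_Suc_Diff1[OF finT v] by simp
    \<comment> \<open>Deleting \<open>v\<close> changes \<open>N\<close> by the degree of
      \<open>v\<close> inside \<open>T\<close> minus 2, which maximality makes nonpositive.\<close>
    ultimately show "degree {e \<in> E. e \<subseteq> T} v \<le> 2"
      using maxN[of "T - {v}"] TV by (auto simp: N_def)
  next
    fix v assume v: "v \<in> V - T"
    define Q where "Q = {e \<in> E. v \<in> e \<and> e \<subseteq> insert v T}"
    have "{e \<in> E. e \<subseteq> insert v T} = {e \<in> E. e \<subseteq> T} \<union> Q" by (auto simp: Q_def)
    also have "card \<dots> = card {e \<in> E. e \<subseteq> T} + card Q"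
      using finite_edges v by (intro card_Un_disjoint) (auto simp: Q_def)
    finally have "N (insert v T) = N T + 2 - int (card Q)"
      using v finT by (simp add: N_def)
    \<comment> \<open>Adding \<open>v\<close> changes \<open>N\<close> by \<open>2 - card Q\<close>.
      Maximality excludes a gain, and the larger size of \<open>insert v T\<close> excludes a tie,
      so \<open>v\<close> sends at least 3 edges to \<open>T\<close> and at most 5 - 3 = 2 remain
      inside \<open>V - T\<close>.\<close>
    moreover have "N (insert v T) \<noteq> N T" using tie[of "insert v T"] v TV finT by auto
    ultimately have "3 \<le> card Q" using maxN[of "insert v T"] v TV by auto
    moreover have "degree {e \<in> E. e \<subseteq> V - T} v + card Q =
        card (incident_edges {e \<in> E. e \<subseteq> V - T} v \<union> Q)"
      unfolding degree_def
    proof (rule card_Un_disjoint[symmetric])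
      have "e \<subseteq> {v}" if "e \<subseteq> V - T" "e \<subseteq> insert v T" for e using that by blast
      then have "\<not> (e \<subseteq> V - T \<and> e \<subseteq> insert v T)" if "e \<in> E" for e
        using edges_two_subsets[OF that] card_mono[of "{v}" e] by force
      then show "incident_edges {e \<in> E. e \<subseteq> V - T} v \<inter> Q = {}"
        by (auto simp: incident_edges_def Q_def)
    qed (use finite_edges in \<open>auto simp: incident_edges_def Q_def\<close>)
    moreover have "\<dots> \<le> degree E v"
      unfolding degree_def using finite_edges by (intro card_mono) (auto simp: incident_edges_def Q_def)
    ultimately show "degree {e \<in> E. e \<subseteq> V - T} v \<le> 2" using deg5[of v] v by simp
  next
    fix X Y assume X: "X \<subseteq> V - T" and Y: "Y \<subseteq> T"
    let ?touch = "{e \<in> E. e \<subseteq> T \<and> e \<inter> Y \<noteq> {}}" and ?X = "{e \<in> E. e \<subseteq> X}"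
      and ?cross = "{e \<in> E. \<exists>x\<in>X. \<exists>t\<in>T - Y. e = {x, t}}" and ?rest = "{e \<in> E. e \<subseteq> T - Y}"
    have "{e \<in> E. e \<subseteq> (T - Y) \<union> X} \<subseteq> ?rest \<union> ?X \<union> ?cross"
    proof
      fix e assume e: "e \<in> {e \<in> E. e \<subseteq> (T - Y) \<union> X}"
      then obtain a b where "e = {a, b}" using edges_two_subsets card_2_iff by (metis mem_Collect_eq)
      then show "e \<in> ?rest \<union> ?X \<union> ?cross" using e by auto
    qed
    then have "card {e \<in> E. e \<subseteq> (T - Y) \<union> X} \<le> card (?rest \<union> ?X \<union> ?cross)"
      using finite_edges by (intro card_mono) auto
    moreover have "card (?rest \<union> ?X \<union> ?cross) \<le> card (?rest \<union> ?X) + card ?cross"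
      "card (?rest \<union> ?X) \<le> card ?rest + card ?X" by (rule card_Un_le)+
    ultimately have 1: "card {e \<in> E. e \<subseteq> (T - Y) \<union> X} \<le> card ?rest + card ?X + card ?cross"
      by linarith
    have split: "{e \<in> E. e \<subseteq> T} = ?rest \<union> ?touch" by auto
    have 2: "card {e \<in> E. e \<subseteq> T} = card ?rest + card ?touch"
      unfolding split using finite_edges by (intro card_Un_disjoint) auto
    have "card ((T - Y) \<union> X) = card (T - Y) + card X"
      using X finT finite_subset[OF X] finite_verts by (intro card_Un_disjoint) auto
    moreover have "card T = card (T - Y) + card Y"
      using Y finT by (simp add: card_Diff_subset card_mono finite_subset)
    ultimately show "2 * card X + card ?touch \<le> 2 * card Y + card ?X + card ?cross"
      using maxN[of "(T - Y) \<union> X"] TV X 1 2 unfolding N_def by fastforce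
  qed
qed

section \<open>From degree colourings to total labellings\<close>

text \<open>With label 2 exactly on \<open>H\<close>, the edges at \<open>v\<close> contribute
  \<open>2 ^ degree H v\<close>. The vertex label supplies one more factor 2 precisely when
  \<open>c v\<close> is the larger option, so the product at \<open>v\<close> is
  \<open>2 ^ c v\<close>.\<close>

lemma (in finite_simple_graph) product_proper_of_degrees:
  assumes H: "H \<subseteq> E" and c: "\<And>v. v \<in> V \<Longrightarrow> c v = degree H v \<or> c v = Suc (degree H v)"
    and proper: "\<And>u v. {u, v} \<in> E \<Longrightarrow> c u \<noteq> c v"
  obtains l where "total_labelling V E 2 l" "product_proper E l"
proof
  define l :: "'a + 'a set \<Rightarrow> nat" where
    "l = case_sum (\<lambda>v. if c v = degree H v then 1 else 2) (\<lambda>e. if e \<in> H then 2 else 1)"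
  show "total_labelling V E 2 l" by (auto simp: total_labelling_def l_def)
  have "vertex_product E l v = 2 ^ c v" if "v \<in> V" for v
  proof -
    have fin: "finite (incident_edges E v)" using finite_edges by (simp add: incident_edges_def)
    have "incident_edges H v = incident_edges E v \<inter> H" using H by (auto simp: incident_edges_def)
    then have "(\<Prod>e\<in>incident_edges E v. l (Inr e)) = 2 ^ degree H v"
      using fin by (simp add: l_def degree_def prod.If_cases)
    then show ?thesis using c[OF that] by (auto simp: vertex_product_def l_def)
  qed
  then show "product_proper E l"
    using proper edge_ends by (auto simp: product_proper_def)
qed

lemma (in finite_simple_graph) obtain_product_proper_labelling:
  assumes deg5: "\<And>v. v \<in> V \<Longrightarrow> degree E v \<le> 5"
  obtains l where "total_labelling V E 2 l" "product_proper E l"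
proof -
  obtain T where TV: "T \<subseteq> V" and degT: "\<And>v. v \<in> T \<Longrightarrow> degree {e \<in> E. e \<subseteq> T} v \<le> 2"
    and degS: "\<And>v. v \<in> V - T \<Longrightarrow> degree {e \<in> E. e \<subseteq> V - T} v \<le> 2"
    and exchange: "\<And>X Y. X \<subseteq> V - T \<Longrightarrow> Y \<subseteq> T \<Longrightarrow>
      2 * card X + card {e \<in> E. e \<subseteq> T \<and> e \<inter> Y \<noteq> {}} \<le>
      2 * card Y + card {e \<in> E. e \<subseteq> X} + card {e \<in> E. \<exists>x\<in>X. \<exists>t\<in>T - Y. e = {x, t}}"
    using obtain_exchange_stable_set deg5 by blast
  define S where "S = V - T"
  define FT where "FT = {e \<in> E. e \<subseteq> T}"
  define FS where "FS = {e \<in> E. e \<subseteq> S}"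
  have fin: "finite S" "finite T" "finite FS" "finite FT"
    using TV finite_verts finite_edges finite_subset by (auto simp: S_def FS_def FT_def)
  have ST: "S \<inter> T = {}" "V = S \<union> T" using TV by (auto simp: S_def)
  have "finite_simple_graph T FT" "finite_simple_graph S FS"
    using fin edges_two_subsets by (auto simp: FT_def FS_def finite_simple_graph_def)
  then obtain hT hS where hT: "colouring_orientation T FT hT" and hS: "colouring_orientation S FS hS"
    using ex_colouring_orientation[of T FT] ex_colouring_orientation[of S FS] degT degS
    by (auto simp: FT_def FS_def S_def)
  have hT_in: "hT e \<in> e" if "e \<in> FT" for e using hT that by (auto simp: colouring_orientation_def)
  have hS_in: "hS e \<in> e" if "e \<in> FS" for e using hS that by (auto simp: colouring_orientation_def)
  define tS where "tS e = the_elem (e - {hS e})" for e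
  have tS: "e = {hS e, tS e} \<and> hS e \<noteq> tS e" if e: "e \<in> FS" for e
  proof -
    have "card e = 2" using e edges_two_subsets by (auto simp: FS_def)
    then obtain b where "e = {hS e, b}" "hS e \<noteq> b"
      using hS_in[OF e] by (metis card_2_iff doubleton_eq_iff insertE singletonD)
    moreover from this have "e - {hS e} = {b}" by blast
    ultimately show ?thesis by (simp add: tS_def)
  qed
  have tS_neq: "hS e \<noteq> tS e" and tS_in: "tS e \<in> e" if "e \<in> FS" for e
    using tS[OF that] by (blast, metis insertI1 insert_commute)
  define inT where "inT v = card {e \<in> FT. hT e = v}" for v
  define inS where "inS v = card {e \<in> FS. hS e = v}" for v
  define outS where "outS v = card {e \<in> FS. tS e = v}" for v
  have inT2: "inT v \<le> 2" if "v \<in> T" for v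
  proof -
    have "inT v \<le> degree FT v"
      unfolding inT_def degree_def incident_edges_def using fin hT_in by (intro card_mono) auto
    then show ?thesis using degT[OF that] by (simp add: FT_def)
  qed
  have inout: "inS v + outS v = degree FS v" for v
  proof -
    have "v \<in> e \<longleftrightarrow> hS e = v \<or> tS e = v" if "e \<in> FS" for e
      using tS[OF that] by (metis insert_iff singletonD)
    then have "incident_edges FS v = {e \<in> FS. hS e = v} \<union> {e \<in> FS. tS e = v}"
      by (auto simp: incident_edges_def)
    moreover have "card \<dots> = inS v + outS v"
      unfolding inS_def outS_def using fin by (intro card_Un_disjoint) (auto dest: tS_neq)
    ultimately show ?thesis by (simp add: degree_def)
  qed
  have inout2: "inS v + outS v \<le> 2" if "v \<in> S" for v
    using degS[of v] that unfolding inout by (simp add: FS_def S_def)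
  define C where "C = {p \<in> S \<times> T. {fst p, snd p} \<in> E}"
  obtain M where MC: "M \<subseteq> C" and rows: "\<And>x. x \<in> S \<Longrightarrow> card {p \<in> M. fst p = x} = 2 - outS x"
    and cols: "\<And>t. card {p \<in> M. snd p = t} \<le> (if t \<in> T then 2 - inT t else 0)"
  proof (rule bipartite_factor[OF fin(1,2), of C "\<lambda>x. 2 - outS x" "\<lambda>t. if t \<in> T then 2 - inT t else 0"])
    show "C \<subseteq> S \<times> T" by (auto simp: C_def)
    fix X Y assume XY: "X \<subseteq> S" "Y \<subseteq> T"
    have finXY: "finite X" "finite Y" using XY fin finite_subset by blast+
    \<comment> \<open>Hall's condition: an edge inside \<open>X\<close> has its tail in
      \<open>X\<close>, so the demand of \<open>X\<close> is at most \<open>2 * card X\<close> minus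
      the number of these edges. An edge of \<open>FT\<close> with head in \<open>Y\<close> touches
      \<open>Y\<close>, so the capacity of \<open>Y\<close> is at least \<open>2 * card Y\<close>
      minus the number of edges inside \<open>T\<close> touching \<open>Y\<close>. The rest is
      \<open>exchange\<close>.\<close>
    have "(\<Sum>x\<in>X. 2 - outS x) + (\<Sum>x\<in>X. outS x) = (\<Sum>x\<in>X. 2)"
      unfolding sum.distrib[symmetric] using XY inout2 by (intro sum.cong) fastforce+
    moreover have "(\<Sum>x\<in>X. outS x) = card {e \<in> FS. tS e \<in> X}"
      unfolding outS_def by (rule sum_card_fibres[OF fin(3) finXY(1)])
    moreover have "card {e \<in> E. e \<subseteq> X} \<le> card {e \<in> FS. tS e \<in> X}"
      using fin tS_in XY by (intro card_mono) (auto simp: FS_def)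
    moreover have "(\<Sum>t\<in>Y. if t \<in> T then 2 - inT t else 0) + (\<Sum>t\<in>Y. inT t) = (\<Sum>t\<in>Y. 2)"
      unfolding sum.distrib[symmetric] using XY inT2 by (intro sum.cong) fastforce+
    moreover have "(\<Sum>t\<in>Y. inT t) = card {e \<in> FT. hT e \<in> Y}"
      unfolding inT_def by (rule sum_card_fibres[OF fin(4) finXY(2)])
    moreover have "card {e \<in> FT. hT e \<in> Y} \<le> card {e \<in> E. e \<subseteq> T \<and> e \<inter> Y \<noteq> {}}"
      using finite_edges hT_in by (intro card_mono) (auto simp: FT_def)
    moreover have "card {e \<in> E. \<exists>x\<in>X. \<exists>t\<in>T - Y. e = {x, t}} \<le> card {p \<in> C. fst p \<in> X \<and> snd p \<notin> Y}"
    proof (rule surj_card_le)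
      show "finite {p \<in> C. fst p \<in> X \<and> snd p \<notin> Y}"
        using fin by (auto simp: C_def intro: finite_subset[of _ "S \<times> T"])
      show "{e \<in> E. \<exists>x\<in>X. \<exists>t\<in>T - Y. e = {x, t}} \<subseteq>
          (\<lambda>p. {fst p, snd p}) ` {p \<in> C. fst p \<in> X \<and> snd p \<notin> Y}"
      proof
        fix e assume "e \<in> {e \<in> E. \<exists>x\<in>X. \<exists>t\<in>T - Y. e = {x, t}}"
        then obtain x t where "x \<in> X" "t \<in> T - Y" "e = {x, t}" "e \<in> E" by blast
        then show "e \<in> (\<lambda>p. {fst p, snd p}) ` {p \<in> C. fst p \<in> X \<and> snd p \<notin> Y}"
          using XY by (intro image_eqI[of _ _ "(x, t)"]) (auto simp: C_def)
      qed
    qed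
    ultimately show "(\<Sum>x\<in>X. 2 - outS x) \<le> (\<Sum>t\<in>Y. if t \<in> T then 2 - inT t else 0) +
        card {p \<in> C. fst p \<in> X \<and> snd p \<notin> Y}"
      using exchange[of X Y] XY by (simp add: S_def)
  qed blast
  have "\<forall>t\<in>T. card {p \<in> M. snd p = t} + card {e \<in> FT. hT e = t} \<le> 2"
  proof
    fix t assume "t \<in> T"
    then show "card {p \<in> M. snd p = t} + card {e \<in> FT. hT e = t} \<le> 2"
      using cols[of t] inT2[of t] by (simp add: inT_def)
  qed
  then obtain KT cT where KT: "KT \<subseteq> FT" and cT: "\<And>u v. {u, v} \<in> FT \<Longrightarrow> cT u \<noteq> cT v"
    "\<And>t. t \<in> T \<Longrightarrow> cT t \<le> 2" "\<And>t. t \<in> T \<Longrightarrow>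
      cT t = card {p \<in> M. snd p = t} + degree KT t \<or>
      cT t = Suc (card {p \<in> M. snd p = t} + degree KT t)"
    by (rule colouring_orientationE[OF hT]) (rule that)
  \<comment> \<open>The orientation is applied with the largest value it admits,
    \<open>2 - inS v\<close>, and not with the actual outer degree \<open>2 - outS v\<close>;
    complementing the inner edges makes up the difference.\<close>
  have "\<forall>v\<in>S. (2 - inS v) + card {e \<in> FS. hS e = v} \<le> 2"
  proof
    fix v assume "v \<in> S"
    then show "(2 - inS v) + card {e \<in> FS. hS e = v} \<le> 2"
      using inout2[of v] by (simp add: inS_def)
  qed
  then obtain KS cS where KS: "KS \<subseteq> FS" and cS: "\<And>u v. {u, v} \<in> FS \<Longrightarrow> cS u \<noteq> cS v"
    "\<And>v. v \<in> S \<Longrightarrow> cS v \<le> 2" "\<And>v. v \<in> S \<Longrightarrow>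
      cS v = 2 - inS v + degree KS v \<or> cS v = Suc (2 - inS v + degree KS v)"
    by (rule colouring_orientationE[OF hS]) (rule that)
  define HM where "HM = (\<lambda>p. {fst p, snd p}) ` M"
  define H where "H = HM \<union> KT \<union> (FS - KS)"
  have MST: "fst p \<in> S" "snd p \<in> T" "fst p \<notin> T" "snd p \<notin> S" if "p \<in> M" for p
  proof -
    have "p \<in> S \<times> T" using that MC unfolding C_def by blast
    then show "fst p \<in> S" "snd p \<in> T" "fst p \<notin> T" "snd p \<notin> S" using ST(1) by auto
  qed
  have "finite M" by (rule finite_subset[of _ "S \<times> T"]) (use MC fin in \<open>auto simp: C_def\<close>)
  then have finH: "finite HM" "finite KT" "finite (FS - KS)" "finite KS"
    using fin finite_subset[OF KT] finite_subset[OF KS] by (simp_all add: HM_def)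
  have inc_H: "incident_edges H v =
      incident_edges HM v \<union> incident_edges KT v \<union> incident_edges (FS - KS) v" for v
    by (auto simp: H_def incident_edges_def)
  have inc_T: "degree H t = card {p \<in> M. snd p = t} + degree KT t" if t: "t \<in> T" for t
  proof -
    have "incident_edges HM t = (\<lambda>p. {fst p, snd p}) ` {p \<in> M. snd p = t}"
      using t by (auto simp: incident_edges_def HM_def dest: MST)
    moreover have "incident_edges (FS - KS) t = {}"
      using t ST(1) by (auto simp: incident_edges_def FS_def)
    ultimately have "incident_edges H t =
        (\<lambda>p. {fst p, snd p}) ` {p \<in> M. snd p = t} \<union> incident_edges KT t"
      unfolding inc_H by simp
    moreover have "card \<dots> = card ((\<lambda>p. {fst p, snd p}) ` {p \<in> M. snd p = t}) + degree KT t"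
      unfolding degree_def
    proof (rule card_Un_disjoint)
      show "finite ((\<lambda>p. {fst p, snd p}) ` {p \<in> M. snd p = t})"
        by (rule finite_subset[OF _ finH(1)]) (auto simp: HM_def)
    qed (use KT finH in \<open>auto simp: incident_edges_def FT_def dest: MST\<close>)
    moreover have "card ((\<lambda>p. {fst p, snd p}) ` {p \<in> M. snd p = t}) = card {p \<in> M. snd p = t}"
      by (rule card_image) (auto simp: inj_on_def doubleton_eq_iff)
    ultimately show ?thesis by (simp add: degree_def)
  qed
  have inc_S: "degree H v = card {p \<in> M. fst p = v} + (degree FS v - degree KS v)" if v: "v \<in> S" for v
  proof -
    have "incident_edges HM v = (\<lambda>p. {fst p, snd p}) ` {p \<in> M. fst p = v}"
      using v by (auto simp: incident_edges_def HM_def dest: MST)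
    moreover have "incident_edges KT v = {}"
      using v ST(1) KT by (auto simp: incident_edges_def FT_def)
    ultimately have "incident_edges H v =
        (\<lambda>p. {fst p, snd p}) ` {p \<in> M. fst p = v} \<union> incident_edges (FS - KS) v"
      unfolding inc_H by simp
    moreover have "card \<dots> = card ((\<lambda>p. {fst p, snd p}) ` {p \<in> M. fst p = v}) + degree (FS - KS) v"
      unfolding degree_def
    proof (rule card_Un_disjoint)
      show "finite ((\<lambda>p. {fst p, snd p}) ` {p \<in> M. fst p = v})"
        by (rule finite_subset[OF _ finH(1)]) (auto simp: HM_def)
      show "finite (incident_edges (FS - KS) v)" using finH by (simp add: incident_edges_def)
    qed (auto simp: incident_edges_def FS_def dest: MST)
    moreover have "card ((\<lambda>p. {fst p, snd p}) ` {p \<in> M. fst p = v}) = card {p \<in> M. fst p = v}"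
      by (rule card_image) (auto simp: inj_on_def doubleton_eq_iff)
    moreover have "incident_edges (FS - KS) v = incident_edges FS v - incident_edges KS v"
      by (auto simp: incident_edges_def)
    moreover have "card \<dots> = degree FS v - degree KS v"
      unfolding degree_def using finH KS by (intro card_Diff_subset) (auto simp: incident_edges_def)
    ultimately show ?thesis by (simp add: degree_def)
  qed
  define c where "c v = (if v \<in> T then cT v else 5 - cS v)" for v
  show ?thesis
  proof (rule product_proper_of_degrees[of H c])
    show "H \<subseteq> E" using MC KT by (auto simp: H_def HM_def C_def FT_def FS_def)
    fix v assume "v \<in> V"
    then consider "v \<in> T" | "v \<in> S" "v \<notin> T" using ST by blast
    then show "c v = degree H v \<or> c v = Suc (degree H v)"
    proof cases
      case 1
      then show ?thesis using cT(3)[OF 1] inc_T[OF 1] by (simp add: c_def)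
    next
      case 2
      have "degree KS v \<le> degree FS v"
        unfolding degree_def using KS fin by (intro card_mono) (auto simp: incident_edges_def)
      \<comment> \<open>Here \<open>degree H v\<close> equals \<open>(2 - outS v) + (inS v + outS v
        - degree KS v) = 2 + inS v - degree KS v\<close>. Since \<open>cS v\<close> is
        \<open>2 - inS v + degree KS v\<close> or one more, \<open>5 - cS v\<close> is
        \<open>degree H v + 1\<close> or \<open>degree H v\<close>.\<close>
      then show ?thesis
        using cS(2,3)[OF 2(1)] inc_S[OF 2(1)] rows[OF 2(1)] inout[of v] inout2[OF 2(1)] 2(2)
        by (auto simp: c_def)
    qed
  next
    fix u v assume uv: "{u, v} \<in> E"
    then have "u \<in> V" "v \<in> V" using edge_ends by blast+
    then consider "u \<in> T" "v \<in> T" | "u \<in> S" "u \<notin> T" "v \<in> S" "v \<notin> T"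
      | "u \<in> T" "v \<in> S" "v \<notin> T" | "u \<in> S" "u \<notin> T" "v \<in> T"
      using ST by blast
    then show "c u \<noteq> c v"
    proof cases
      case 1
      then show ?thesis using cT(1)[of u v] uv by (simp add: c_def FT_def)
    next
      case 2
      then show ?thesis using cS(1)[of u v] cS(2)[of u] cS(2)[of v] uv by (simp add: c_def FS_def)
    next
      case 3
      then show ?thesis using cT(2)[of u] cS(2)[of v] by (simp add: c_def)
    next
      case 4
      then show ?thesis using cT(2)[of v] cS(2)[of u] by (simp add: c_def)
    qed
  qed (rule that)
qed

theorem theorem1p2:
  fixes V :: "'a set" and E :: "'a set set"
  assumes "finite_simple_graph V E"
    and "max_degree V E = 5"
  shows "product_total_chromatic V E \<le> 2 \<and>
    (\<exists>l :: 'a + 'a set \<Rightarrow> nat. (\<forall>z \<in> V <+> E. l z \<in> {1, 2}) \<and>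
      (\<forall>u v. {u, v} \<in> E \<longrightarrow>
        l (Inl u) * (\<Prod>x \<in> neighbourhood E u. l (Inr {u, x})) \<noteq>
        l (Inl v) * (\<Prod>x \<in> neighbourhood E v. l (Inr {v, x}))))"
proof -
  interpret finite_simple_graph V E by (rule assms(1))
  have "degree E v \<le> 5" if "v \<in> V" for v
    using assms(2) finite_verts that unfolding max_degree_def by (metis Max_ge finite_imageI
      finite_insert image_eqI insertI2)
  then obtain l where l: "total_labelling V E 2 l" "product_proper E l"
    using obtain_product_proper_labelling by blast
  have "product_total_chromatic V E \<le> 2"
    unfolding product_total_chromatic_def by (rule Least_le) (use l in auto)
  moreover have "{1..2::nat} = {1, 2}" by auto
  then have "\<forall>z \<in> V <+> E. l z \<in> {1, 2}" using l(1) unfolding total_labelling_def by simp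
  moreover note l(2)[unfolded product_proper_def vertex_product_conv]
  ultimately show ?thesis by blast
qed

end
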